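(* Every graphic sequence $\pi=(d_1,\ldots,d_n)$ with $\min\{d_1,\ldots,d_n\}\ge 6$ has a realization with a strongly connected modulo $3$-orientation.
   Context: All graphs are finite and have no loops; a simple graph also has no multiple edges. An integer-valued sequence $\pi=(d_1,\ldots,d_n)$ is graphic if there is a nontrivial simple graph with degree sequence $\pi$; any such simple graph is called a realization of $\pi$. A modulo $3$-orientation of a graph is an orientation such that at every vertex the indegree is congruent to the outdegree modulo $3$. An orientation is strongly connected if for any two vertices $x,y$ there is a directed path from $x$ to $y$. *)

theory Defs
  imports "Graph_Theory.Graph_Theory" "HOL-Number_Theory.Cong"
begin

text \<open>
  A finite simple graph is a \<^locale>\<open>pair_graph\<close>: a finite, loopfree, symmetric digraph without
  parallel arcs, in which the edge \<open>uv\<close> is represented by the two arcs \<open>(u, v)\<close> and \<open>(v, u)\<close>.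
  Hence the degree of \<open>v\<close> in the simple graph is its out-degree in the symmetric digraph.
  Nontrivial means having at least two vertices.  The list \<open>vs\<close> is the enumeration
  \<open>v\<^sub>1, \<dots>, v\<^sub>n\<close> of the vertices with \<open>d(v\<^sub>i) = d\<^sub>i\<close>.
\<close>

definition realization :: "'a pair_pre_digraph \<Rightarrow> int list \<Rightarrow> bool" where
  "realization G \<pi> \<longleftrightarrow>
     pair_graph G \<and> card (pverts G) \<ge> 2 \<and>
     (\<exists>vs. distinct vs \<and> set vs = pverts G \<and>
           \<pi> = map (\<lambda>v. int (out_degree (with_proj G) v)) vs)"

text \<open>
  Every finite graph is isomorphic to one whose vertices are natural numbers, so taking
  the vertices from \<^typ>\<open>nat\<close> is no restriction.
\<close>

definition graphic :: "int list \<Rightarrow> bool" where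
  "graphic \<pi> \<longleftrightarrow> (\<exists>G :: nat pair_pre_digraph. realization G \<pi>)"

text \<open>An orientation keeps exactly one of the two arcs representing each edge.\<close>

definition orientation :: "'a pair_pre_digraph \<Rightarrow> 'a pair_pre_digraph \<Rightarrow> bool" where
  "orientation D G \<longleftrightarrow>
     pverts D = pverts G \<and> parcs D \<subseteq> parcs G \<and>
     (\<forall>u v. (u, v) \<in> parcs G \<longrightarrow> ((u, v) \<in> parcs D \<longleftrightarrow> (v, u) \<notin> parcs D))"

definition modulo3_orientation :: "'a pair_pre_digraph \<Rightarrow> 'a pair_pre_digraph \<Rightarrow> bool" where
  "modulo3_orientation D G \<longleftrightarrow>
     orientation D G \<and>
     (\<forall>v \<in> pverts D. [in_degree (with_proj D) v = out_degree (with_proj D) v] (mod 3))"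

end

theory Submission
  imports Defs
begin

text \<open>
  Assign to the vertices of even degree the value \<open>\<delta> v = 0\<close> and to those of odd degree the values
  \<open>\<delta> v = 3\<close> and \<open>\<delta> v = -3\<close>, each equally often.  It suffices to find a realization with a strongly
  connected orientation in which out-degree minus in-degree (the excess) equals \<open>\<delta>\<close>.  Among all
  oriented realizations take one that first minimises the total deviation of the excess from \<open>\<delta>\<close>
  and then has a maximal reachability relation.  A directed path from a vertex with too large to
  one with too small an excess could be reversed to decrease the deviation.  So if the orientation is
  not as desired, there are \<open>r\<close> and \<open>t\<close> with \<open>t\<close> unreachable from \<open>r\<close>, such that the excess is at least
  \<open>\<delta>\<close> below \<open>r\<close> and at most \<open>\<delta>\<close> above \<open>t\<close>.  Let \<open>X\<close> be a sink component below \<open>r\<close> and \<open>Z\<close> a source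
  component above \<open>t\<close>.  As \<open>\<bar>\<delta>\<bar> \<le> 3\<close> and degrees are at least 6, counting the edges that leave \<open>X\<close> gives
  \<open>a \<in> X\<close> with at least 4 neighbours in \<open>X\<close> and at most 3 outside, and likewise \<open>c \<in> Z\<close>.  Hence there
  are edges \<open>ab\<close> in \<open>X\<close> and \<open>cd\<close> in \<open>Z\<close> such that \<open>ad\<close> and \<open>bc\<close> are not edges.  Replacing \<open>ab\<close>, \<open>cd\<close> by
  \<open>ad\<close>, \<open>bc\<close> keeps all degrees and, after reversing a directed cycle if necessary, all excesses,
  but it merges \<open>X\<close> and \<open>Z\<close> into one strong component: a contradiction.
\<close>

section \<open>Degrees, excesses and cuts of oriented arc sets\<close>

definition outdeg :: "('a \<times> 'a) set \<Rightarrow> 'a \<Rightarrow> nat" where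
  "outdeg R v = card (R `` {v})"

definition total_deg :: "('a \<times> 'a) set \<Rightarrow> 'a \<Rightarrow> nat" where
  "total_deg R v = outdeg R v + outdeg (R\<inverse>) v"

definition excess :: "('a \<times> 'a) set \<Rightarrow> 'a \<Rightarrow> int" where
  "excess R v = int (outdeg R v) - int (outdeg (R\<inverse>) v)"

definition support :: "('a \<times> 'a) set \<Rightarrow> ('a \<times> 'a) set" where
  "support R = R \<union> R\<inverse>"

text \<open>One relation carries both the graph and its orientation: \<open>support R\<close> is the
  symmetric arc set of the underlying simple graph. Disjointness from the converse excludes loops as
  well as opposite arcs.\<close>

definition oriented :: "('a \<times> 'a) set \<Rightarrow> bool" where
  "oriented R \<longleftrightarrow> finite R \<and> R \<inter> R\<inverse> = {}"

lemma orientedD: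
  assumes "oriented R"
  shows "finite R" "(x, y) \<in> R \<Longrightarrow> (y, x) \<notin> R" "(x, x) \<notin> R"
  using assms by (auto simp: oriented_def)

lemma oriented_converse [simp]: "oriented (R\<inverse>) \<longleftrightarrow> oriented R"
  by (auto simp: oriented_def)

lemma support_converse [simp]: "support (R\<inverse>) = support R"
  by (auto simp: support_def)

lemma excess_converse [simp]: "excess (R\<inverse>) v = - excess R v"
  by (simp add: excess_def)

lemma total_deg_converse [simp]: "total_deg (R\<inverse>) v = total_deg R v"
  by (simp add: total_deg_def)

lemma support_sym: "(x, y) \<in> support R \<longleftrightarrow> (y, x) \<in> support R"
  by (auto simp: support_def)

lemma finite_Image_singleton: "finite R \<Longrightarrow> finite (R `` {v})"
  by (rule finite_subset[of _ "snd ` R"]) force+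

lemma outdeg_insert:
  assumes "finite R" "(x, y) \<notin> R"
  shows "outdeg (insert (x, y) R) v = outdeg R v + of_bool (v = x)"
proof (cases "v = x")
  case True
  then have "insert (x, y) R `` {v} = insert y (R `` {v})" by auto
  then show ?thesis
    using assms True finite_Image_singleton[of R v] by (simp add: outdeg_def)
next
  case False
  then have "insert (x, y) R `` {v} = R `` {v}" by auto
  then show ?thesis using False by (simp add: outdeg_def)
qed

lemma indeg_insert:
  assumes "finite R" "(x, y) \<notin> R"
  shows "outdeg ((insert (x, y) R)\<inverse>) v = outdeg (R\<inverse>) v + of_bool (v = y)"
proof -
  have "(insert (x, y) R)\<inverse> = insert (y, x) (R\<inverse>)" by auto
  then show ?thesis using outdeg_insert[of "R\<inverse>" y x v] assms by simp
qed

lemma excess_insert: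
  assumes "finite R" "(x, y) \<notin> R"
  shows "excess (insert (x, y) R) v = excess R v + of_bool (v = x) - of_bool (v = y)"
  unfolding excess_def outdeg_insert[OF assms] indeg_insert[OF assms] by simp

lemma total_deg_insert:
  assumes "finite R" "(x, y) \<notin> R"
  shows "total_deg (insert (x, y) R) v = total_deg R v + of_bool (v = x) + of_bool (v = y)"
  unfolding total_deg_def outdeg_insert[OF assms] indeg_insert[OF assms] by simp

lemma total_deg_eq_card_support:
  assumes "oriented R"
  shows "total_deg R v = card (support R `` {v})"
proof -
  have "support R `` {v} = R `` {v} \<union> R\<inverse> `` {v}" by (auto simp: support_def)
  moreover have "R `` {v} \<inter> R\<inverse> `` {v} = {}" using assms by (auto simp: oriented_def)
  ultimately show ?thesis
    using assms finite_Image_singleton[of R v] finite_Image_singleton[of "R\<inverse>" v]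
    by (simp add: total_deg_def outdeg_def card_Un_disjoint oriented_def)
qed

lemma total_deg_cong_support:
  assumes "oriented R" "oriented R'" "support R' = support R"
  shows "total_deg R' v = total_deg R v"
  using assms by (simp add: total_deg_eq_card_support)

lemma sum_outdeg:
  assumes "finite R" "finite S"
  shows "(\<Sum>v\<in>S. outdeg R v) = card (R \<inter> S \<times> UNIV)"
  using assms(1)
proof (induction R)
  case empty
  then show ?case by (simp add: outdeg_def)
next
  case (insert e R)
  obtain x y where e: "e = (x, y)" by force
  have "insert (x, y) R \<inter> S \<times> UNIV =
      (if x \<in> S then insert (x, y) (R \<inter> S \<times> UNIV) else R \<inter> S \<times> UNIV)" by auto
  then show ?case
    using insert assms(2) by (simp add: e outdeg_insert sum.distrib of_bool_def)
qed

text \<open>An arc with both ends in \<open>S\<close> contributes 1 and -1 to the sum, so only the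
  arcs crossing the boundary of \<open>S\<close> count.\<close>

lemma sum_excess_eq_cut:
  assumes "finite R" "finite S"
  shows "(\<Sum>v\<in>S. excess R v) = int (card (R \<inter> S \<times> (- S))) - int (card (R \<inter> (- S) \<times> S))"
  using assms(1)
proof (induction R)
  case empty
  then show ?case by (simp add: excess_def outdeg_def)
next
  case (insert e R)
  obtain x y where e: "e = (x, y)" by force
  have "insert (x, y) R \<inter> S \<times> (- S) =
      (if x \<in> S \<and> y \<notin> S then insert (x, y) (R \<inter> S \<times> (- S)) else R \<inter> S \<times> (- S))"
    "insert (x, y) R \<inter> (- S) \<times> S =
      (if x \<notin> S \<and> y \<in> S then insert (x, y) (R \<inter> (- S) \<times> S) else R \<inter> (- S) \<times> S)" by auto
  then show ?case
    using insert assms(2)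
    by (simp add: e excess_insert sum.distrib sum_subtractf of_bool_def)
qed

section \<open>Reachable sets and their dependence on the excesses\<close>

lemma finite_reachable: "finite R \<Longrightarrow> finite (R\<^sup>* `` {x})"
proof (rule finite_subset)
  show "R\<^sup>* `` {x} \<subseteq> insert x (snd ` R)"
  proof
    fix y assume "y \<in> R\<^sup>* `` {x}"
    then have "(x, y) \<in> R\<^sup>*" by simp
    then show "y \<in> insert x (snd ` R)" by (cases rule: rtranclE) force+
  qed
qed simp

lemma closed_reachable: "(x, y) \<in> R\<^sup>* \<Longrightarrow> R `` S \<subseteq> S \<Longrightarrow> x \<in> S \<Longrightarrow> y \<in> S"
  by (induction rule: rtrancl_induct) auto

text \<open>
  For a fixed underlying graph, the excesses determine the number of arcs leaving a vertex set,
  hence which sets are closed under successors.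
\<close>

lemma rtrancl_cong_excess:
  assumes R: "oriented R" and R': "oriented R'" and supp: "support R' = support R"
    and exc: "\<And>v. excess R' v = excess R v"
  shows "R\<^sup>* \<subseteq> R'\<^sup>*"
proof clarify
  fix u v assume uv: "(u, v) \<in> R\<^sup>*"
  define S where "S = R'\<^sup>* `` {u}"
  have fin: "finite R" "finite R'" "finite S"
    using orientedD(1)[OF R] orientedD(1)[OF R'] finite_reachable by (auto simp: S_def)
  \<comment> \<open>The sum of the two cut sizes depends only on the support, their difference only
    on the excesses. So \<open>R\<close> and \<open>R'\<close> have equally many arcs leaving
    \<open>S\<close>, namely none.\<close>
  have cut: "card (Q \<inter> S \<times> (- S)) + card (Q \<inter> (- S) \<times> S) = card (support Q \<inter> S \<times> (- S))"
    if Q: "oriented Q" for Q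
  proof -
    have "card (Q \<inter> (- S) \<times> S) = card ((Q \<inter> (- S) \<times> S)\<inverse>)" by simp
    also have "(Q \<inter> (- S) \<times> S)\<inverse> = Q\<inverse> \<inter> S \<times> (- S)" by auto
    finally have "card (Q \<inter> S \<times> (- S)) + card (Q \<inter> (- S) \<times> S) =
        card (Q \<inter> S \<times> (- S)) + card (Q\<inverse> \<inter> S \<times> (- S))" by simp
    also have "\<dots> = card (Q \<inter> S \<times> (- S) \<union> Q\<inverse> \<inter> S \<times> (- S))"
      using Q by (intro card_Un_disjoint [symmetric]) (auto simp: oriented_def)
    also have "Q \<inter> S \<times> (- S) \<union> Q\<inverse> \<inter> S \<times> (- S) = support Q \<inter> S \<times> (- S)"
      by (auto simp: support_def)
    finally show ?thesis .
  qed
  have "R' \<inter> S \<times> (- S) = {}" by (auto simp: S_def intro: rtrancl_into_rtrancl)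
  then have "card (R \<inter> S \<times> (- S)) = 0"
    using cut[OF R] cut[OF R'] sum_excess_eq_cut[OF fin(1,3)] sum_excess_eq_cut[OF fin(2,3)]
    by (simp add: exc supp)
  then have "R \<inter> S \<times> (- S) = {}" using fin by simp
  then have "R `` S \<subseteq> S" by blast
  then have "v \<in> S" by (rule closed_reachable[OF uv]) (simp add: S_def)
  then show "(u, v) \<in> R'\<^sup>*" by (simp add: S_def)
qed

section \<open>Reversal of directed paths and cycles\<close>

text \<open>The arc by which a walk leaves \<open>u\<close> for the last time does not recur
  afterwards. This permits its deletion in the induction for \<open>reverse_path\<close>.\<close>

lemma rtrancl_first_arc:
  assumes "(u, v) \<in> R\<^sup>*" "u \<noteq> v"
  shows "\<exists>w. (u, w) \<in> R \<and> (w, v) \<in> (R - {(u, w)})\<^sup>*"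
  using assms
proof (induction rule: rtrancl_induct)
  case base
  then show ?case by simp
next
  case (step y z)
  show ?case
  proof (cases "u = y")
    case True
    then show ?thesis using step by blast
  next
    case False
    then obtain w where "(u, w) \<in> R" "(w, y) \<in> (R - {(u, w)})\<^sup>*" using step by blast
    moreover have "(y, z) \<in> R - {(u, w)}" using step False by simp
    ultimately show ?thesis by (meson rtrancl_into_rtrancl)
  qed
qed

text \<open>Induction on the number of arcs: delete the first arc, reverse the rest of the path,
  insert the first arc backwards. The last conjunct locates the changed arcs; \<open>switch\<close>
  uses it to see that a distant arc survives.\<close>

lemma reverse_path:
  assumes "oriented R" "(u, v) \<in> R\<^sup>*"
  shows "\<exists>R'. oriented R' \<and> support R' = support R \<and>
    (\<forall>w. excess R' w = excess R w - 2 * of_bool (w = u) + 2 * of_bool (w = v)) \<and>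
    (\<forall>x y. (x, y) \<in> R - R' \<longrightarrow> (u, x) \<in> R\<^sup>*)"
  using assms
proof (induction "card R" arbitrary: R u rule: less_induct)
  case less
  show ?case
  proof (cases "u = v")
    case True
    then show ?thesis using less.prems by (intro exI[of _ R]) auto
  next
    case False
    obtain w where w: "(u, w) \<in> R" "(w, v) \<in> (R - {(u, w)})\<^sup>*"
      using rtrancl_first_arc[OF less.prems(2) False] by blast
    define Q where "Q = R - {(u, w)}"
    have R: "R = insert (u, w) Q" "(u, w) \<notin> Q" using w by (auto simp: Q_def)
    have finR: "finite R" using less.prems by (simp add: oriented_def)
    have Q: "oriented Q" "finite Q" using less.prems by (auto simp: oriented_def Q_def)
    have "card Q < card R" using R finR by simp
    then obtain Q' where Q': "oriented Q'" "support Q' = support Q"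
      "\<And>x. excess Q' x = excess Q x - 2 * of_bool (x = w) + 2 * of_bool (x = v)"
      "\<And>x y. (x, y) \<in> Q - Q' \<Longrightarrow> (w, x) \<in> Q\<^sup>*"
      using less.hyps[OF _ Q(1)] w(2) unfolding Q_def[symmetric] by metis
    have finQ': "finite Q'" using Q' by (simp add: oriented_def)
    have "(u, w) \<notin> support Q"
      using w(1) orientedD(2)[OF less.prems(1), of u w] by (simp add: support_def Q_def)
    then have new: "(u, w) \<notin> Q'" "(w, u) \<notin> Q'"
      unfolding Q'(2)[symmetric] by (auto simp: support_def)
    have "u \<noteq> w" using orientedD[OF less.prems(1)] w by auto
    define R' where "R' = insert (w, u) Q'"
    have "oriented R'"
      using Q'(1) new \<open>u \<noteq> w\<close> unfolding R'_def oriented_def by auto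
    moreover have "support R' = support R"
      using Q'(2) unfolding R'_def R(1) support_def by blast
    moreover have "excess R' x = excess R x - 2 * of_bool (x = u) + 2 * of_bool (x = v)" for x
      unfolding R'_def R(1) excess_insert[OF finQ' new(2)] excess_insert[OF Q(2) R(2)] Q'(3)
      by simp
    moreover have "(u, x) \<in> R\<^sup>*" if "(x, y) \<in> R - R'" for x y
    proof (cases "(x, y) = (u, w)")
      case False
      then have "(x, y) \<in> Q - Q'" using that R(1) by (auto simp: R'_def)
      then have "(w, x) \<in> Q\<^sup>*" by (rule Q'(4))
      then have "(w, x) \<in> R\<^sup>*" using rtrancl_mono[of Q R] R(1) by blast
      then show ?thesis using w(1) by (rule converse_rtrancl_into_rtrancl[rotated])
    qed simp
    ultimately show ?thesis by blast
  qed
qed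

text \<open>The arc \<open>(b, a)\<close> closes the path to a directed cycle. Reversing the path
  shifts the excesses of \<open>a\<close> and \<open>b\<close> by two, and turning the arc undoes
  both shifts.\<close>

lemma flip_arc:
  assumes R: "oriented R" and ba: "(b, a) \<in> R" and ab: "(a, b) \<in> R\<^sup>*"
  shows "\<exists>R'. oriented R' \<and> support R' = support R \<and> (\<forall>w. excess R' w = excess R w) \<and>
    (a, b) \<in> R' \<and> (\<forall>x y. (x, y) \<in> R - R' \<longrightarrow> (a, x) \<in> R\<^sup>*)"
proof -
  have "a \<noteq> b" using orientedD[OF R] ba by auto
  define Q where "Q = R - {(b, a)}"
  have Re: "R = insert (b, a) Q" "(b, a) \<notin> Q" using ba by (auto simp: Q_def)
  have Q: "oriented Q" "finite Q" using R by (auto simp: oriented_def Q_def)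
  \<comment> \<open>A walk from \<open>a\<close> stopped at its first visit to \<open>b\<close> uses
    no arc that starts in \<open>b\<close>.\<close>
  have "(a, b) \<in> Q\<^sup>*" using ab
  proof (induction rule: converse_rtrancl_induct)
    case (step y z)
    then show ?case
      by (cases "y = b") (auto simp: Q_def intro: converse_rtrancl_into_rtrancl)
  qed simp
  then obtain Q' where Q': "oriented Q'" "support Q' = support Q"
    "\<And>x. excess Q' x = excess Q x - 2 * of_bool (x = a) + 2 * of_bool (x = b)"
    "\<And>x y. (x, y) \<in> Q - Q' \<Longrightarrow> (a, x) \<in> Q\<^sup>*"
    using reverse_path[OF Q(1)] by metis
  have finQ': "finite Q'" using Q' by (simp add: oriented_def)
  have "(a, b) \<notin> support Q"
    using ba orientedD(2)[OF R, of b a] by (simp add: support_def Q_def)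
  then have new: "(b, a) \<notin> Q'" "(a, b) \<notin> Q'"
    unfolding Q'(2)[symmetric] by (auto simp: support_def)
  define R' where "R' = insert (a, b) Q'"
  have "oriented R'"
    using Q'(1) new \<open>a \<noteq> b\<close> unfolding R'_def oriented_def by auto
  moreover have "support R' = support R"
    using Q'(2) unfolding R'_def Re(1) support_def by blast
  moreover have "excess R' x = excess R x" for x
    unfolding R'_def Re(1) excess_insert[OF finQ' new(2)] excess_insert[OF Q(2) Re(2)] Q'(3)
    by simp
  moreover have "(a, x) \<in> R\<^sup>*" if "(x, y) \<in> R - R'" for x y
  proof (cases "(x, y) = (b, a)")
    case True
    then show ?thesis using ab by simp
  next
    case False
    then have "(x, y) \<in> Q - Q'" using that Re(1) by (auto simp: R'_def)
    then have "(a, x) \<in> Q\<^sup>*" by (rule Q'(4))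
    then show ?thesis using rtrancl_mono[of Q R] Re(1) by blast
  qed
  ultimately show ?thesis unfolding R'_def by blast
qed

section \<open>Edge switches between two strong components\<close>

text \<open>Stop the walk at its first visit to \<open>v\<close>. The restriction shows that a path
  inside a component survives the deletion of the two switched arcs.\<close>

lemma rtrancl_restrict:
  assumes "(u, v) \<in> R\<^sup>*"
  shows "(u, v) \<in> (R \<inter> {(x, y). x \<noteq> v \<and> (u, x) \<in> R\<^sup>* \<and> (y, v) \<in> R\<^sup>*})\<^sup>*"
  using assms
proof (induction rule: converse_rtrancl_induct)
  case base
  then show ?case by simp
next
  case (step u y)
  show ?case
  proof (cases "u = v")
    case False
    let ?S = "\<lambda>u. R \<inter> {(x, y). x \<noteq> v \<and> (u, x) \<in> R\<^sup>* \<and> (y, v) \<in> R\<^sup>*}"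
    have "?S y \<subseteq> ?S u" using step(1) by (auto intro: converse_rtrancl_into_rtrancl)
    then have "(y, v) \<in> (?S u)\<^sup>*" using step.IH rtrancl_mono by blast
    moreover have "(u, y) \<in> ?S u" using step False by auto
    ultimately show ?thesis by (rule converse_rtrancl_into_rtrancl[rotated])
  qed simp
qed

text \<open>Replacing \<open>(a, b)\<close>, \<open>(c, d)\<close> by \<open>(a, d)\<close>,
  \<open>(c, b)\<close> keeps every outdegree and indegree. The new arcs and the old paths from
  \<open>d\<close> to \<open>c\<close> and from \<open>b\<close> to \<open>a\<close> form a closed
  walk, which joins the two components.\<close>

lemma switch_aligned:
  assumes R: "oriented R" and ab: "(a, b) \<in> R" and cd: "(c, d) \<in> R"
    and ba: "(b, a) \<in> R\<^sup>*" and dc: "(d, c) \<in> R\<^sup>*" and ac: "(a, c) \<notin> R\<^sup>*"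
    and ad: "(a, d) \<notin> support R" and bc: "(b, c) \<notin> support R"
  shows "\<exists>R'. oriented R' \<and> support R' \<subseteq> support R \<union> {(a, d), (d, a), (b, c), (c, b)} \<and>
    (\<forall>v. excess R' v = excess R v) \<and> (\<forall>v. total_deg R' v = total_deg R v) \<and> R\<^sup>* \<subset> R'\<^sup>*"
proof -
  define Q where "Q = R - {(a, b), (c, d)}"
  have bc': "(b, c) \<notin> R\<^sup>*" using ac ab by (meson converse_rtrancl_into_rtrancl)
  have ad': "(a, d) \<notin> R\<^sup>*" using ac dc by (meson rtrancl_trans)
  have neq: "a \<noteq> c" "a \<noteq> d" "b \<noteq> c" "b \<noteq> d" "a \<noteq> b" "c \<noteq> d"
    using ac bc' ad' ab cd orientedD[OF R] dc by auto
  have finQ: "finite Q" using R by (simp add: Q_def oriented_def)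
  have Re: "R = insert (a, b) (insert (c, d) Q)"
    and notin: "(c, d) \<notin> Q" "(a, b) \<notin> insert (c, d) Q"
    using ab cd neq by (auto simp: Q_def)
  define R' where "R' = insert (a, d) (insert (c, b) Q)"
  have notin': "(c, b) \<notin> Q" "(a, d) \<notin> insert (c, b) Q"
    using ad bc neq by (auto simp: Q_def support_def)
  have "oriented R'"
    using R ad bc neq unfolding oriented_def R'_def Q_def support_def by auto
  moreover have "support R' \<subseteq> support R \<union> {(a, d), (d, a), (b, c), (c, b)}"
    unfolding R'_def Q_def support_def by auto
  moreover have "excess R' v = excess R v" for v
    using finQ notin notin' unfolding R'_def Re by (simp add: excess_insert)
  moreover have "total_deg R' v = total_deg R v" for v
    using finQ notin notin' unfolding R'_def Re by (simp add: total_deg_insert)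
  moreover have "R\<^sup>* \<subset> R'\<^sup>*"
  proof
    have QR': "Q \<subseteq> R'" by (auto simp: R'_def)
    \<comment> \<open>The arc \<open>(c, d)\<close> is excluded because it starts in
      \<open>c\<close>, and \<open>(a, b)\<close> because \<open>b\<close> does not reach
      \<open>c\<close>.\<close>
    have "R \<inter> {(x, y). x \<noteq> c \<and> (d, x) \<in> R\<^sup>* \<and> (y, c) \<in> R\<^sup>*} \<subseteq> Q"
      using bc' by (auto simp: Q_def)
    then have "R \<inter> {(x, y). x \<noteq> c \<and> (d, x) \<in> R\<^sup>* \<and> (y, c) \<in> R\<^sup>*} \<subseteq> R'" using QR' by simp
    then have dc': "(d, c) \<in> R'\<^sup>*" using rtrancl_restrict[OF dc] rtrancl_mono by blast
    have "R \<inter> {(x, y). x \<noteq> a \<and> (b, x) \<in> R\<^sup>* \<and> (y, a) \<in> R\<^sup>*} \<subseteq> Q"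
      using bc' by (auto simp: Q_def)
    then have "R \<inter> {(x, y). x \<noteq> a \<and> (b, x) \<in> R\<^sup>* \<and> (y, a) \<in> R\<^sup>*} \<subseteq> R'" using QR' by simp
    then have ba': "(b, a) \<in> R'\<^sup>*" using rtrancl_restrict[OF ba] rtrancl_mono by blast
    have ad'': "(a, d) \<in> R'\<^sup>*" and cb'': "(c, b) \<in> R'\<^sup>*" by (auto simp: R'_def)
    have "(a, b) \<in> R'\<^sup>*" "(c, d) \<in> R'\<^sup>*"
      using ad'' dc' cb'' ba' by (meson rtrancl_trans)+
    then have "R \<subseteq> R'\<^sup>*" using QR' unfolding Re by blast
    then show "R\<^sup>* \<subseteq> R'\<^sup>*" by (rule rtrancl_subset_rtrancl)
    show "R\<^sup>* \<noteq> R'\<^sup>*" using ad' ad'' by blast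
  qed
  ultimately show ?thesis by blast
qed

text \<open>Only edges are given here, so their directions may disagree. In that case one of them is
  turned by \<open>flip_arc\<close>, which keeps the excesses and hence reachability, and
  \<open>switch_aligned\<close> applies.\<close>

lemma switch:
  assumes R: "oriented R" and ab: "(a, b) \<in> support R" and cd: "(c, d) \<in> support R"
    and sab: "(a, b) \<in> R\<^sup>*" "(b, a) \<in> R\<^sup>*" and scd: "(c, d) \<in> R\<^sup>*" "(d, c) \<in> R\<^sup>*"
    and ac: "(a, c) \<notin> R\<^sup>*"
    and ad: "(a, d) \<notin> support R" and bc: "(b, c) \<notin> support R"
  shows "\<exists>R'. oriented R' \<and> support R' \<subseteq> support R \<union> {(a, d), (d, a), (b, c), (c, b)} \<and>
    (\<forall>v. excess R' v = excess R v) \<and> (\<forall>v. total_deg R' v = total_deg R v) \<and> R\<^sup>* \<subset> R'\<^sup>*"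
proof -
  have bd: "(b, d) \<notin> R\<^sup>*" using sab scd ac by (meson rtrancl_trans)
  \<comment> \<open>Both disagreeing cases are instances: \<open>(y, x)\<close> is the arc to be
    turned, \<open>(p, q)\<close> the one to be kept. The set equation \<open>e\<close> absorbs the
    renaming.\<close>
  have mixed: ?thesis if ab': "(y, x) \<in> R" "(x, y) \<in> R\<^sup>*" "(y, x) \<in> R\<^sup>*"
    and cd': "(p, q) \<in> R" "(q, p) \<in> R\<^sup>*" and xp: "(x, p) \<notin> R\<^sup>*"
    and n: "(x, q) \<notin> support R" "(y, p) \<notin> support R"
    and e: "{(x, q), (q, x), (y, p), (p, y)} = {(a, d), (d, a), (b, c), (c, b)}" for x y p q
  proof -
    obtain R1 where R1: "oriented R1" "support R1 = support R" "\<And>w. excess R1 w = excess R w"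
      "(x, y) \<in> R1" "\<And>u v. (u, v) \<in> R - R1 \<Longrightarrow> (x, u) \<in> R\<^sup>*"
      using flip_arc[OF R ab'(1,2)] by metis
    have eq: "R1\<^sup>* = R\<^sup>*"
      using rtrancl_cong_excess[OF R R1(1-3)] rtrancl_cong_excess[OF R1(1) R] R1(2,3)
      by (simp add: subset_antisym)
    \<comment> \<open>Every changed arc starts at a vertex reachable from \<open>x\<close>, and
      \<open>p\<close> is not one.\<close>
    have "(p, q) \<in> R1" using R1(5) cd'(1) xp by blast
    from switch_aligned[OF R1(1,4) this, unfolded eq R1(2,3) e
        total_deg_cong_support[OF R R1(1,2)], OF ab'(3) cd'(2) xp n]
    show ?thesis .
  qed
  consider "(a, b) \<in> R" "(c, d) \<in> R" | "(b, a) \<in> R" "(d, c) \<in> R"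
    | "(b, a) \<in> R" "(c, d) \<in> R" | "(a, b) \<in> R" "(d, c) \<in> R"
    using ab cd by (auto simp: support_def)
  then show ?thesis
  proof cases
    case 1
    then show ?thesis using switch_aligned[OF R 1 sab(2) scd(2) ac ad bc] by simp
  next
    case 2
    have "{(b, c), (c, b), (a, d), (d, a)} = {(a, d), (d, a), (b, c), (c, b)}" by auto
    then show ?thesis using switch_aligned[OF R 2 sab(1) scd(1) bd bc ad] by simp
  next
    case 3
    show ?thesis by (rule mixed[OF 3(1) sab 3(2) scd(2) ac ad bc refl])
  next
    case 4
    show ?thesis
      by (rule mixed[OF 4(1) sab(2,1) 4(2) scd(1) bd bc ad]) auto
  qed
qed

section \<open>Sink and source components, and the growth of reachability\<close>

text \<open>A vertex below \<open>r\<close> with the smallest reachable set works: its successors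
  cannot reach less.\<close>

lemma sink_component:
  assumes "finite R"
  shows "\<exists>x. (r, x) \<in> R\<^sup>* \<and> (\<forall>v. (x, v) \<in> R\<^sup>* \<longrightarrow> (v, x) \<in> R\<^sup>*)"
proof -
  obtain x where x: "(r, x) \<in> R\<^sup>*"
    and least: "\<And>y. (r, y) \<in> R\<^sup>* \<Longrightarrow> card (R\<^sup>* `` {x}) \<le> card (R\<^sup>* `` {y})"
    using ex_has_least_nat[of "\<lambda>y. (r, y) \<in> R\<^sup>*" r "\<lambda>y. card (R\<^sup>* `` {y})"] by auto
  have "(v, x) \<in> R\<^sup>*" if v: "(x, v) \<in> R\<^sup>*" for v
  proof -
    have "R\<^sup>* `` {v} \<subseteq> R\<^sup>* `` {x}" using v by auto
    then have "R\<^sup>* `` {v} = R\<^sup>* `` {x}"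
      using least[OF rtrancl_trans[OF x v]] by (intro card_seteq finite_reachable assms)
    then show ?thesis by blast
  qed
  then show ?thesis using x by blast
qed

text \<open>Otherwise each \<open>v\<close> in \<open>X\<close> has more than
  \<open>- \<delta> v\<close> neighbours outside \<open>X\<close>. All edges to the outside are
  directed into \<open>X\<close>, so their number is minus the total excess of \<open>X\<close>,
  which is at most the sum of the \<open>- \<delta> v\<close>.\<close>

lemma vertex_with_few_outer_neighbours:
  assumes R: "oriented R" and X: "finite X" "X \<noteq> {}" "R `` X \<subseteq> X"
    and exc: "\<And>v. v \<in> X \<Longrightarrow> \<delta> v \<le> excess R v"
    and deg: "\<And>v. v \<in> X \<Longrightarrow> 6 \<le> total_deg R v"
    and \<delta>: "\<And>v. v \<in> X \<Longrightarrow> \<delta> v = 0 \<or> - 3 \<le> \<delta> v \<and> 7 \<le> total_deg R v"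
  shows "\<exists>a\<in>X. card (support R `` {a} - X) \<le> 3 \<and> 4 \<le> card (support R `` {a} \<inter> X)"
proof (rule ccontr)
  assume none: "\<not> ?thesis"
  let ?o = "\<lambda>a. card (support R `` {a} - X)"
  have fin: "finite R" using R by (simp add: oriented_def)
  have big: "- \<delta> a < int (?o a)" if a: "a \<in> X" for a
  proof -
    have "finite (support R `` {a})"
      using fin by (intro finite_Image_singleton) (simp add: support_def)
    then have "total_deg R a = ?o a + card (support R `` {a} \<inter> X)"
      using total_deg_eq_card_support[OF R, of a]
      by (simp add: card_Diff_subset_Int card_mono)
    then show ?thesis using none a deg[OF a] \<delta>[OF a] by force
  qed
  let ?C = "R \<inter> (- X) \<times> X"
  have "R \<inter> X \<times> (- X) = {}" using X(3) by auto
  then have "(\<Sum>v\<in>X. excess R v) = - int (card ?C)"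
    using sum_excess_eq_cut[OF fin X(1)] by simp
  moreover have "card ?C = (\<Sum>v\<in>X. ?o v)"
  proof -
    have "(?C\<inverse>) \<inter> X \<times> UNIV = ?C\<inverse>" by auto
    then have "card ?C = card ((?C\<inverse>) \<inter> X \<times> UNIV)" by simp
    also have "\<dots> = (\<Sum>v\<in>X. outdeg (?C\<inverse>) v)"
      using sum_outdeg[of "?C\<inverse>" X] fin X(1) by simp
    also have "\<dots> = (\<Sum>v\<in>X. ?o v)"
    proof (rule sum.cong[OF refl])
      fix v assume "v \<in> X"
      then have "?C\<inverse> `` {v} = support R `` {v} - X"
        using X(3) by (auto simp: support_def)
      then show "outdeg (?C\<inverse>) v = ?o v" by (simp add: outdeg_def)
    qed
    finally show ?thesis .
  qed
  moreover have "(\<Sum>v\<in>X. - \<delta> v) < (\<Sum>v\<in>X. int (?o v))"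
    using X(1,2) big by (rule sum_strict_mono)
  moreover have "(\<Sum>v\<in>X. \<delta> v) \<le> (\<Sum>v\<in>X. excess R v)"
    using exc by (rule sum_mono)
  ultimately show False by (simp add: sum_negf)
qed

lemma enlarge_reachability:
  assumes R: "oriented R" and V: "support R \<subseteq> V \<times> V" "r \<in> V" "t \<in> V"
    and rt: "(r, t) \<notin> R\<^sup>*"
    and above: "\<And>v. (r, v) \<in> R\<^sup>* \<Longrightarrow> \<delta> v \<le> excess R v"
    and below: "\<And>v. (v, t) \<in> R\<^sup>* \<Longrightarrow> excess R v \<le> \<delta> v"
    and deg: "\<And>v. v \<in> V \<Longrightarrow> 6 \<le> total_deg R v"
    and \<delta>: "\<And>v. v \<in> V \<Longrightarrow> \<delta> v = 0 \<or> \<bar>\<delta> v\<bar> \<le> 3 \<and> 7 \<le> total_deg R v"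
  shows "\<exists>R'. oriented R' \<and> support R' \<subseteq> V \<times> V \<and> (\<forall>v. excess R' v = excess R v) \<and>
    (\<forall>v. total_deg R' v = total_deg R v) \<and> R\<^sup>* \<subset> R'\<^sup>*"
proof -
  have fin: "finite R" using R by (simp add: oriented_def)
  have RV: "R `` V \<subseteq> V" "R\<inverse> `` V \<subseteq> V" using V(1) by (auto simp: support_def)
  obtain x where x: "(r, x) \<in> R\<^sup>*" "\<And>v. (x, v) \<in> R\<^sup>* \<Longrightarrow> (v, x) \<in> R\<^sup>*"
    using sink_component[OF fin] by blast
  \<comment> \<open>A source component of \<open>R\<close> is a sink component of the converse;
    \<open>c\<close> is found below in the same way, with \<open>\<delta>\<close> negated.\<close>
  obtain z where z: "(z, t) \<in> R\<^sup>*" "\<And>v. (v, z) \<in> R\<^sup>* \<Longrightarrow> (z, v) \<in> R\<^sup>*"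
    using sink_component[of "R\<inverse>" t] fin by (auto simp: rtrancl_converse)
  define X where "X = R\<^sup>* `` {x}"
  define Z where "Z = (R\<inverse>)\<^sup>* `` {z}"
  have XV: "X \<subseteq> V"
    using closed_reachable[OF _ RV(1) V(2)] x(1) by (auto simp: X_def dest: rtrancl_trans)
  have ZV: "Z \<subseteq> V"
    using closed_reachable[OF _ RV(2) V(3)] z(1)
    by (auto simp: Z_def rtrancl_converse dest: rtrancl_trans)
  have X: "finite X" "X \<noteq> {}" "R `` X \<subseteq> X" "\<And>v. v \<in> X \<Longrightarrow> (r, v) \<in> R\<^sup>*"
    using fin x(1) by (auto simp: X_def finite_reachable intro: rtrancl_into_rtrancl dest: rtrancl_trans)
  have Z: "finite Z" "Z \<noteq> {}" "R\<inverse> `` Z \<subseteq> Z" "\<And>v. v \<in> Z \<Longrightarrow> (v, t) \<in> R\<^sup>*"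
    using fin z(1) finite_reachable[of "R\<inverse>" z]
    by (auto simp: Z_def rtrancl_converse intro: converse_rtrancl_into_rtrancl dest: rtrancl_trans)
  have sX: "(p, q) \<in> R\<^sup>*" if "p \<in> X" "q \<in> X" for p q
    using that x(2) by (auto simp: X_def dest: rtrancl_trans)
  have sZ: "(p, q) \<in> R\<^sup>*" if "p \<in> Z" "q \<in> Z" for p q
    using that z(2) by (auto simp: Z_def rtrancl_converse dest: rtrancl_trans)
  have noXZ: "(p, q) \<notin> R\<^sup>*" if "p \<in> X" "q \<in> Z" for p q
    using X(4)[OF that(1)] Z(4)[OF that(2)] rt by (meson rtrancl_trans)
  have disj: "X \<inter> Z = {}" using noXZ by blast
  obtain a where a: "a \<in> X" "card (support R `` {a} - X) \<le> 3" "4 \<le> card (support R `` {a} \<inter> X)"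
    using vertex_with_few_outer_neighbours[OF R X(1-3), of \<delta>] above X(4) deg \<delta> XV
    by (smt (verit, best) subsetD)
  obtain c where c: "c \<in> Z" "card (support R `` {c} - Z) \<le> 3" "4 \<le> card (support R `` {c} \<inter> Z)"
    using vertex_with_few_outer_neighbours[of "R\<inverse>" Z "\<lambda>v. - \<delta> v"] R Z below deg \<delta> ZV
    by (smt (verit, best) subsetD oriented_converse support_converse excess_converse total_deg_converse)
  have fins: "finite (support R `` {v})" for v
    using fin by (intro finite_Image_singleton) (simp add: support_def)
  \<comment> \<open>Four neighbours of \<open>a\<close> in \<open>X\<close> cannot all be among the
    at most three neighbours of \<open>c\<close> outside \<open>Z\<close>; the choice of
    \<open>d\<close> is symmetric.\<close>
  have "\<not> support R `` {a} \<inter> X \<subseteq> support R `` {c} - Z"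
    using a c card_mono[of "support R `` {c} - Z" "support R `` {a} \<inter> X"] fins by force
  then obtain b where b: "(a, b) \<in> support R" "b \<in> X" "(b, c) \<notin> support R"
    using disj support_sym[of _ c R] by auto
  have "\<not> support R `` {c} \<inter> Z \<subseteq> support R `` {a} - X"
    using a c card_mono[of "support R `` {a} - X" "support R `` {c} \<inter> Z"] fins by force
  then obtain d where d: "(c, d) \<in> support R" "d \<in> Z" "(a, d) \<notin> support R"
    using disj by auto
  have "\<exists>R'. oriented R' \<and> support R' \<subseteq> support R \<union> {(a, d), (d, a), (b, c), (c, b)} \<and>
    (\<forall>v. excess R' v = excess R v) \<and> (\<forall>v. total_deg R' v = total_deg R v) \<and> R\<^sup>* \<subset> R'\<^sup>*"
    using a c b d by (intro switch R sX sZ noXZ)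
  moreover have "support R \<union> {(a, d), (d, a), (b, c), (c, b)} \<subseteq> V \<times> V"
    using V(1) a(1) b(2) c(1) d(2) XV ZV by blast
  ultimately show ?thesis by (meson subset_trans)
qed

section \<open>The extremal orientation\<close>

lemma excess_parity: "even (excess R v) \<longleftrightarrow> even (total_deg R v)"
  by (simp add: excess_def total_deg_def)

lemma sum_excess_eq_0:
  assumes "finite R" "finite V" "support R \<subseteq> V \<times> V"
  shows "(\<Sum>v\<in>V. excess R v) = 0"
proof -
  have "R \<inter> V \<times> (- V) = {}" "R \<inter> (- V) \<times> V = {}" using assms(3) by (auto simp: support_def)
  then show ?thesis using sum_excess_eq_cut[OF assms(1,2)] by simp
qed

lemma exists_strong_orientation_with_excess:
  assumes V: "finite V" and R0: "oriented R\<^sub>0" "support R\<^sub>0 \<subseteq> V \<times> V"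
    and deg: "\<And>v. v \<in> V \<Longrightarrow> 6 \<le> total_deg R\<^sub>0 v"
    and \<delta>: "\<And>v. v \<in> V \<Longrightarrow> \<delta> v = 0 \<or> \<bar>\<delta> v\<bar> \<le> 3 \<and> 7 \<le> total_deg R\<^sub>0 v"
    and parity: "\<And>v. v \<in> V \<Longrightarrow> even (\<delta> v) \<longleftrightarrow> even (total_deg R\<^sub>0 v)"
    and balanced: "(\<Sum>v\<in>V. \<delta> v) = 0"
  shows "\<exists>R. oriented R \<and> support R \<subseteq> V \<times> V \<and> (\<forall>v. total_deg R v = total_deg R\<^sub>0 v) \<and>
    (\<forall>v\<in>V. excess R v = \<delta> v) \<and> V \<times> V \<subseteq> R\<^sup>*"
proof -
  define K where "K = {R. oriented R \<and> support R \<subseteq> V \<times> V \<and> (\<forall>v. total_deg R v = total_deg R\<^sub>0 v)}"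
  define dev where "dev R = (\<Sum>v\<in>V. nat \<bar>excess R v - \<delta> v\<bar>)" for R
  have "R\<^sub>0 \<in> K" using R0 by (simp add: K_def)
  then obtain R1 where R1: "R1 \<in> K" "\<And>R. R \<in> K \<Longrightarrow> dev R1 \<le> dev R"
    using ex_has_least_nat[of "\<lambda>R. R \<in> K" "R\<^sub>0" dev] by auto
  define L where "L = {R \<in> K. dev R = dev R1}"
  have "K \<subseteq> Pow (V \<times> V)" by (auto simp: K_def support_def)
  then have "finite L" using V finite_subset[of L "Pow (V \<times> V)"] by (auto simp: L_def)
  moreover have "L \<noteq> {}" using R1 by (auto simp: L_def)
  \<comment> \<open>Maximality concerns the closures \<open>R\<^sup>*\<close>, not the arc sets,
    since a switch replaces arcs.\<close>
  ultimately obtain R where R: "R \<in> L" "\<And>R'. R' \<in> L \<Longrightarrow> R\<^sup>* \<subseteq> R'\<^sup>* \<Longrightarrow> R\<^sup>* = R'\<^sup>*"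
    using finite_has_maximal[of "rtrancl ` L"] by auto
  have RK: "oriented R" "support R \<subseteq> V \<times> V" "\<And>v. total_deg R v = total_deg R\<^sub>0 v"
    using R(1) by (auto simp: L_def K_def)
  have "R `` V \<subseteq> V" "R\<inverse> `` V \<subseteq> V" using RK(2) by (auto simp: support_def)
  then have closed: "(u, v) \<in> R\<^sup>* \<Longrightarrow> u \<in> V \<Longrightarrow> v \<in> V" "(u, v) \<in> R\<^sup>* \<Longrightarrow> v \<in> V \<Longrightarrow> u \<in> V" for u v
    using closed_reachable[of u v R V] closed_reachable[of v u "R\<inverse>" V]
    by (auto simp: rtrancl_converse)
  have reach: "(r, t) \<in> R\<^sup>*" if rt: "r \<in> V" "t \<in> V"
    "\<And>v. (r, v) \<in> R\<^sup>* \<Longrightarrow> \<delta> v \<le> excess R v" "\<And>v. (v, t) \<in> R\<^sup>* \<Longrightarrow> excess R v \<le> \<delta> v" for r t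
  proof (rule ccontr)
    assume "(r, t) \<notin> R\<^sup>*"
    then obtain R' where R': "oriented R'" "support R' \<subseteq> V \<times> V" "\<And>v. excess R' v = excess R v"
      "\<And>v. total_deg R' v = total_deg R v" "R\<^sup>* \<subset> R'\<^sup>*"
      using enlarge_reachability[OF RK(1,2) rt(1,2) _ rt(3,4)] deg \<delta> RK(3) by metis
    then have "R' \<in> L" using R(1) RK(3) by (simp add: L_def K_def dev_def)
    then show False using R(2) R'(5) by blast
  qed
  have not_reach: "(r, t) \<notin> R\<^sup>*"
    if r: "r \<in> V" "\<delta> r < excess R r" and t: "t \<in> V" "excess R t < \<delta> t" for r t
  proof
    assume "(r, t) \<in> R\<^sup>*"
    then obtain R' where R': "oriented R'" "support R' = support R"
      "\<And>w. excess R' w = excess R w - 2 * of_bool (w = r) + 2 * of_bool (w = t)"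
      using reverse_path[OF RK(1)] by metis
    have "R' \<in> K"
      using R' RK total_deg_cong_support[OF RK(1) R'(1,2)] by (simp add: K_def)
    moreover have "dev R' < dev R"
    proof -
      have "r \<noteq> t" using r t by auto
      \<comment> \<open>By parity a nonzero deviation is at least two, so the shift by two
        overshoots neither at \<open>r\<close> nor at \<open>t\<close>.\<close>
      have ev: "even (excess R v - \<delta> v)" if "v \<in> V" for v
        using that parity excess_parity[of R v] RK(3) by simp
      have rt: "2 \<le> excess R r - \<delta> r" "excess R t - \<delta> t \<le> - 2"
        using r t ev[OF r(1)] ev[OF t(1)] by presburger+
      show ?thesis unfolding dev_def
        using V r(1) rt \<open>r \<noteq> t\<close> by (intro sum_strict_mono_ex1) (auto simp: R'(3))
    qed
    ultimately show False using R1(2) R(1) by (force simp: L_def)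
  qed
  have eq: "excess R v = \<delta> v" if vV: "v \<in> V" for v
  proof (rule ccontr)
    assume v: "excess R v \<noteq> \<delta> v"
    \<comment> \<open>Since both sums vanish, a deviation forces a vertex \<open>r\<close> with
      surplus and a vertex \<open>t\<close> with deficit. By \<open>not_reach\<close> no deficit
      lies below \<open>r\<close> and no surplus above \<open>t\<close>, so \<open>reach\<close>
      gives the forbidden path.\<close>
    have sum: "(\<Sum>v\<in>V. excess R v) = (\<Sum>v\<in>V. \<delta> v)"
      using sum_excess_eq_0[of R V] V RK balanced by (simp add: oriented_def)
    have "\<exists>r\<in>V. \<delta> r < excess R r"
      using sum_strict_mono_ex1[OF V, of "excess R" \<delta>] v vV sum by (force simp: not_less)
    then obtain r where r: "r \<in> V" "\<delta> r < excess R r" by blast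
    have "\<exists>t\<in>V. excess R t < \<delta> t"
      using sum_strict_mono_ex1[OF V, of \<delta> "excess R"] v vV sum by (force simp: not_less)
    then obtain t where t: "t \<in> V" "excess R t < \<delta> t" by blast
    have "(r, t) \<in> R\<^sup>*"
      using not_reach r t closed by (intro reach) (meson linorder_not_less)+
    then show False using not_reach[OF r t] by blast
  qed
  have "V \<times> V \<subseteq> R\<^sup>*"
  proof clarify
    fix u v assume "u \<in> V" "v \<in> V"
    then show "(u, v) \<in> R\<^sup>*" using eq closed by (intro reach) force+
  qed
  then show ?thesis using RK eq by blast
qed

section \<open>Prescribed excesses divisible by three\<close>

lemma balanced_odd_assignment:
  assumes V: "finite V" and even_sum: "even (\<Sum>v\<in>V. d v)"
  shows "\<exists>\<delta> :: 'a \<Rightarrow> int. (\<forall>v\<in>V. if even (d v :: nat) then \<delta> v = 0 else \<delta> v \<in> {-3, 3}) \<and>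
    (\<Sum>v\<in>V. \<delta> v) = 0"
proof -
  define A where "A = {v \<in> V. odd (d v)}"
  have "even (card A)" using even_sum even_sum_iff[OF V, of d] by (simp add: A_def)
  moreover have "finite A" using V by (simp add: A_def)
  ultimately obtain P where P: "P \<subseteq> A" "2 * card P = card A"
    using obtain_subset_with_card_n[of "card A div 2" A] by (metis div_le_dividend dvd_mult_div_cancel)
  \<comment> \<open>The value is 3 on the half \<open>P\<close> of the odd vertices, -3 on the other
    half and 0 elsewhere.\<close>
  define \<delta> :: "'a \<Rightarrow> int" where "\<delta> v = 6 * of_bool (v \<in> P) - 3 * of_bool (v \<in> A)" for v
  have "(\<Sum>v\<in>V. \<delta> v) = 6 * int (card (V \<inter> P)) - 3 * int (card (V \<inter> A))"
    using V by (simp add: \<delta>_def sum_subtractf sum_distrib_left[symmetric] of_bool_def sum.If_cases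
      Int_def)
  moreover have "V \<inter> P = P" "V \<inter> A = A" using P by (auto simp: A_def)
  ultimately have "(\<Sum>v\<in>V. \<delta> v) = 0" using P(2) by simp
  moreover have "if even (d v) then \<delta> v = 0 else \<delta> v \<in> {-3, 3}" if "v \<in> V" for v
    using P(1) that by (auto simp: \<delta>_def A_def)
  ultimately show ?thesis by blast
qed

section \<open>Translation to and from library digraphs\<close>

lemma out_degree_with_proj:
  "out_degree (with_proj D) v = outdeg (parcs D) v"
proof -
  have "out_arcs (with_proj D) v = Pair v ` (parcs D `` {v})"
    by (auto simp: out_arcs_def)
  then show ?thesis by (simp add: out_degree_def outdeg_def card_image inj_on_def)
qed

lemma in_degree_with_proj:
  "in_degree (with_proj D) v = outdeg ((parcs D)\<inverse>) v"
proof -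
  have "in_arcs (with_proj D) v = (\<lambda>u. (u, v)) ` ((parcs D)\<inverse> `` {v})"
    by (auto simp: in_arcs_def)
  then show ?thesis by (simp add: in_degree_def outdeg_def card_image inj_on_def)
qed

lemma strongly_connected_with_proj:
  assumes "V \<noteq> {}" "R \<subseteq> V \<times> V" "V \<times> V \<subseteq> R\<^sup>*"
  shows "strongly_connected (with_proj \<lparr>pverts = V, parcs = R\<rparr>)"
proof -
  let ?D = "with_proj \<lparr>pverts = V, parcs = R\<rparr>"
  have "(u, v) \<in> rtrancl_on V R" if "(u, v) \<in> R\<^sup>*" "u \<in> V" for u v
    using that
  proof (induction rule: rtrancl_induct)
    case (step y z)
    then show ?case using assms(2) by (auto intro: rtrancl_on_into_rtrancl_on)
  qed simp
  moreover have "arcs_ends ?D = R" by (auto simp: arcs_ends_def arc_to_ends_def)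
  ultimately have "u \<rightarrow>\<^sup>*\<^bsub>?D\<^esub> v" if "u \<in> V" "v \<in> V" for u v
    using that assms(3) by (auto simp: reachable_def)
  then show ?thesis using assms(1) by (auto simp: strongly_connected_def)
qed

theorem corollary1p5:
  fixes \<pi> :: "int list"
  assumes "graphic \<pi>" and "Min (set \<pi>) \<ge> 6"
  shows "\<exists>(G :: nat pair_pre_digraph) D.
           realization G \<pi> \<and> modulo3_orientation D G \<and> strongly_connected (with_proj D)"
proof -
  obtain G\<^sub>0 :: "nat pair_pre_digraph" and vs where G0: "pair_graph G\<^sub>0" "card (pverts G\<^sub>0) \<ge> 2"
    and vs: "distinct vs" "set vs = pverts G\<^sub>0"
    and \<pi>: "\<pi> = map (\<lambda>v. int (out_degree (with_proj G\<^sub>0) v)) vs"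
    using assms(1) by (auto simp: graphic_def realization_def)
  interpret G0: pair_graph G\<^sub>0 by (rule G0(1))
  define V where "V = pverts G\<^sub>0"
  have V: "finite V" "card V \<ge> 2" "set vs = V" using G0 vs by (auto simp: V_def)
  \<comment> \<open>The order of the natural numbers supplies an acyclic initial
    orientation.\<close>
  define R\<^sub>0 where "R\<^sub>0 = {(u, v) \<in> parcs G\<^sub>0. u < v}"
  have "sym (parcs G\<^sub>0)" using G0.sym_arcs by (auto simp: symmetric_def arcs_ends_def arc_to_ends_def)
  then have supp0: "support R\<^sub>0 = parcs G\<^sub>0"
    using G0.no_loops by (fastforce simp: support_def R\<^sub>0_def dest: symD)
  have R0: "oriented R\<^sub>0" "support R\<^sub>0 \<subseteq> V \<times> V"
    using supp0 G0.wellformed' finite_subset[of R\<^sub>0 "parcs G\<^sub>0"] G0.pair_finite_arcs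
    by (auto simp: oriented_def R\<^sub>0_def V_def)
  have out_deg: "outdeg (support R) v = total_deg R v" if "oriented R" for R and v :: nat
    using total_deg_eq_card_support[OF that] by (simp add: outdeg_def)
  have \<pi>': "\<pi> = map (\<lambda>v. int (total_deg R\<^sub>0 v)) vs"
    using \<pi> out_deg[OF R0(1)] by (simp add: out_degree_with_proj supp0)
  have deg: "6 \<le> total_deg R\<^sub>0 v" if "v \<in> V" for v
  proof -
    have "int (total_deg R\<^sub>0 v) \<in> set \<pi>" using that V by (simp add: \<pi>')
    then have "Min (set \<pi>) \<le> int (total_deg R\<^sub>0 v)" by simp
    then show ?thesis using assms(2) by linarith
  qed
  \<comment> \<open>The handshake lemma in disguise: excess and degree agree in parity at each
    vertex, and the excesses sum to zero.\<close>
  have "even (\<Sum>v\<in>V. excess R\<^sub>0 v)"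
    using sum_excess_eq_0[of R\<^sub>0 V] R0 V by (simp add: oriented_def)
  then have "even (\<Sum>v\<in>V. total_deg R\<^sub>0 v)"
    using even_sum_iff[OF V(1), of "excess R\<^sub>0"] even_sum_iff[OF V(1), of "total_deg R\<^sub>0"]
    by (simp add: excess_parity)
  then obtain \<delta> :: "nat \<Rightarrow> int" where
    \<delta>: "\<And>v. v \<in> V \<Longrightarrow> if even (total_deg R\<^sub>0 v) then \<delta> v = 0 else \<delta> v \<in> {-3, 3}"
    and balanced: "(\<Sum>v\<in>V. \<delta> v) = 0"
    using balanced_odd_assignment[OF V(1), of "total_deg R\<^sub>0"] by blast
  have \<delta>_range: "\<delta> v = 0 \<or> \<bar>\<delta> v\<bar> \<le> 3 \<and> 7 \<le> total_deg R\<^sub>0 v" if v: "v \<in> V" for v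
  proof (cases "even (total_deg R\<^sub>0 v)")
    case True
    then show ?thesis using \<delta>[OF v] by auto
  next
    case False
    \<comment> \<open>An odd degree of at least 6 is at least 7, which pays for the values 3 and
      -3.\<close>
    then have "total_deg R\<^sub>0 v \<noteq> 6" by auto
    then show ?thesis using \<delta>[OF v] deg[OF v] False by auto
  qed
  have \<delta>_parity: "even (\<delta> v) \<longleftrightarrow> even (total_deg R\<^sub>0 v)" if "v \<in> V" for v
    using \<delta>[OF that] by (auto split: if_splits)
  obtain R where R: "oriented R" "support R \<subseteq> V \<times> V" "\<And>v. total_deg R v = total_deg R\<^sub>0 v"
    "\<And>v. v \<in> V \<Longrightarrow> excess R v = \<delta> v" "V \<times> V \<subseteq> R\<^sup>*"
    using exists_strong_orientation_with_excess[OF V(1) R0 deg \<delta>_range \<delta>_parity balanced] by metis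
  define G where "G = \<lparr>pverts = V, parcs = support R\<rparr>"
  define D where "D = \<lparr>pverts = V, parcs = R\<rparr>"
  have finR: "finite R" using R(1) by (simp add: oriented_def)
  have "pair_graph G"
  proof
    show "symmetric (with_proj G)"
      by (auto simp: symmetric_def arcs_ends_def arc_to_ends_def G_def support_def intro!: symI)
  qed (use R(1,2) V finR in \<open>auto simp: G_def support_def oriented_def\<close>)
  \<comment> \<open>Every vertex has kept its degree, so the old enumeration \<open>vs\<close> still
    serves.\<close>
  moreover have "\<pi> = map (\<lambda>v. int (out_degree (with_proj G) v)) vs"
    using out_deg[OF R(1)] R(3) by (simp add: \<pi>' out_degree_with_proj G_def)
  ultimately have "realization G \<pi>"
    using V vs(1) unfolding realization_def by (auto simp: G_def)
  moreover have "modulo3_orientation D G"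
  proof -
    have "[in_degree (with_proj D) v = out_degree (with_proj D) v] (mod 3)" if v: "v \<in> V" for v
    proof -
      have "3 dvd excess R v" using R(4)[OF v] \<delta>[OF v] by (auto split: if_splits)
      then have "[int (outdeg R v) = int (outdeg (R\<inverse>) v)] (mod int 3)"
        by (simp add: excess_def cong_iff_dvd_diff)
      then have "[outdeg R v = outdeg (R\<inverse>) v] (mod 3)" by (simp only: cong_int_iff)
      then show ?thesis
        by (simp add: in_degree_with_proj out_degree_with_proj D_def cong_sym)
    qed
    moreover have "orientation D G"
      using R(1) by (auto simp: orientation_def D_def G_def support_def oriented_def)
    ultimately show ?thesis by (simp add: modulo3_orientation_def D_def)
  qed
  moreover have "strongly_connected (with_proj D)"
    unfolding D_def using V R(2,5) by (intro strongly_connected_with_proj) (auto simp: support_def)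
  ultimately show ?thesis by blast
qed

end
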